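(* Let $\mathcal{M}$ and $\mathcal{N}$ be two almost-moon polyominoes such that $\mathcal{N}$ is obtained from $\mathcal{M}$ by an interchange of two adjacent rows, and assume neither has an exceptional row other than the two swapped rows. Let $\mathbf{r}$ be a vector with entries in $\{0,1\}$ indexed by the rows of $\mathcal{M}$ and $\mathbf{c}$ a vector of nonnegative integers indexed by the columns. Then there is a map $\psi_{\mathcal{M},\mathcal{N}}:\mathcal{F}(\mathcal{M},\mathbf{r},\mathbf{c})\to\mathcal{F}(\mathcal{N},\mathbf{r}',\mathbf{c})$ such that $\mathrm{ne}(\psi_{\mathcal{M},\mathcal{N}}(M))=\mathrm{ne}(M)$ for all $M\in\mathcal{F}(\mathcal{M},\mathbf{r},\mathbf{c})$, where $\mathbf{r}'$ is obtained from $\mathbf{r}$ by exchanging the entries corresponding to the two swapped rows.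
   Context: A polyomino is a finite set of cells $(i,j)\in\mathbb{Z}^2$, $i$ the column coordinate and $j$ the row coordinate; rows/columns are the sets of cells with fixed $j$/fixed $i$, lengths are numbers of cells. Two rows are comparable if the set of column coordinates of one contains that of the other. A row $\mathcal{R}$ is exceptional if there is a row above and a row below $\mathcal{R}$, both longer than $\mathcal{R}$. An almost-moon polyomino is a polyomino whose rows are connected and pairwise comparable, with at most one exceptional row. Interchanging two adjacent rows means moving the cells of one row to the vertical position of the other and vice versa, keeping column coordinates. An ne-chain of size $k$ in a 01-filling of a polyomino $\mathcal{P}$ is a set of $k$ cells $(i_1,j_1),\dots,(i_k,j_k)$ filled with 1, $i_1<\dots<i_k$, $j_1<\dots<j_k$, such that all cells $(i_r,j_s)$, $1\le r,s\le k$, lie in $\mathcal{P}$; $\mathrm{ne}(M)$ is the maximal size of an ne-chain in $M$. $\mathcal{F}(\mathcal{P},\mathbf{r},\mathbf{c})$ is the set of 01-fillings of $\mathcal{P}$ with row sums $\mathbf{r}$ and column sums $\mathbf{c}$. *)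

theory Defs
  imports Main "HOL-Library.FuncSet" "HOL-Combinatorics.Transposition"
begin

type_synonym cell = "int \<times> int"

text \<open>A cell is a pair (column coordinate, row coordinate); a polyomino is a finite cell set.
  The rows and columns of a polyomino are the nonempty ones, indexed by their coordinate.\<close>

definition rows :: "cell set \<Rightarrow> int set" where
  "rows P = snd ` P"

definition columns :: "cell set \<Rightarrow> int set" where
  "columns P = fst ` P"

definition row_cols :: "cell set \<Rightarrow> int \<Rightarrow> int set" where
  "row_cols P j = {i. (i, j) \<in> P}"

definition col_rows :: "cell set \<Rightarrow> int \<Rightarrow> int set" where
  "col_rows P i = {j. (i, j) \<in> P}"

definition row_length :: "cell set \<Rightarrow> int \<Rightarrow> nat" where
  "row_length P j = card (row_cols P j)"

definition row_connected :: "cell set \<Rightarrow> int \<Rightarrow> bool" where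
  "row_connected P j \<longleftrightarrow>
     (\<forall>i\<in>row_cols P j. \<forall>i'\<in>row_cols P j. {i..i'} \<subseteq> row_cols P j)"

definition rows_comparable :: "cell set \<Rightarrow> int \<Rightarrow> int \<Rightarrow> bool" where
  "rows_comparable P j j' \<longleftrightarrow>
     row_cols P j \<subseteq> row_cols P j' \<or> row_cols P j' \<subseteq> row_cols P j"

definition exceptional_row :: "cell set \<Rightarrow> int \<Rightarrow> bool" where
  "exceptional_row P j \<longleftrightarrow> j \<in> rows P \<and>
     (\<exists>u\<in>rows P. j < u \<and> row_length P j < row_length P u) \<and>
     (\<exists>d\<in>rows P. d < j \<and> row_length P j < row_length P d)"

definition almost_moon :: "cell set \<Rightarrow> bool" where
  "almost_moon P \<longleftrightarrow> finite P \<and>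
     (\<forall>j\<in>rows P. row_connected P j) \<and>
     (\<forall>j\<in>rows P. \<forall>j'\<in>rows P. rows_comparable P j j') \<and>
     (\<forall>j j'. exceptional_row P j \<and> exceptional_row P j' \<longrightarrow> j = j')"

text \<open>Polyominoes may have empty lines, so two rows count as adjacent when no row lies strictly
  between them; this includes rows at consecutive heights.\<close>

definition adjacent_rows :: "cell set \<Rightarrow> int \<Rightarrow> int \<Rightarrow> bool" where
  "adjacent_rows P a b \<longleftrightarrow>
     a \<in> rows P \<and> b \<in> rows P \<and> a < b \<and> rows P \<inter> {a<..<b} = {}"

definition interchange_rows :: "int \<Rightarrow> int \<Rightarrow> cell set \<Rightarrow> cell set" where
  "interchange_rows a b P = (\<lambda>(i, j). (i, transpose a b j)) ` P"

text \<open>The 01-fillings of \<open>P\<close>, extensional outside \<open>P\<close>, with the given row and column sums.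
  The values of \<open>r\<close> and \<open>c\<close> outside the rows and columns of \<open>P\<close> are irrelevant.\<close>

definition fillings :: "cell set \<Rightarrow> (int \<Rightarrow> nat) \<Rightarrow> (int \<Rightarrow> nat) \<Rightarrow> (cell \<Rightarrow> nat) set" where
  "fillings P r c = {f \<in> P \<rightarrow>\<^sub>E {0, 1}.
     (\<forall>j\<in>rows P. (\<Sum>i\<in>row_cols P j. f (i, j)) = r j) \<and>
     (\<forall>i\<in>columns P. (\<Sum>j\<in>col_rows P i. f (i, j)) = c i)}"

definition ne_chain :: "cell set \<Rightarrow> (cell \<Rightarrow> nat) \<Rightarrow> nat \<Rightarrow> cell set \<Rightarrow> bool" where
  "ne_chain P f k C \<longleftrightarrow> (\<exists>x y :: nat \<Rightarrow> int.
     C = (\<lambda>s. (x s, y s)) ` {1..k} \<and>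
     strict_mono_on {1..k} x \<and> strict_mono_on {1..k} y \<and>
     (\<forall>s\<in>{1..k}. f (x s, y s) = 1) \<and>
     (\<forall>s\<in>{1..k}. \<forall>t\<in>{1..k}. (x s, y t) \<in> P))"

text \<open>For finite \<open>P\<close> the set below is finite, and it contains 0 because of the empty chain.\<close>

definition ne :: "cell set \<Rightarrow> (cell \<Rightarrow> nat) \<Rightarrow> nat" where
  "ne P f = Max {k. \<exists>C. ne_chain P f k C}"

end

theory Submission
  imports Defs
begin

text \<open>After a half turn of the plane we may assume that the upper row \<open>b\<close> is contained in the
  lower row \<open>a\<close>. Every row carries at most one 1; let \<open>p\<close> and \<open>q\<close> be the columns of the 1s in
  rows \<open>a\<close> and \<open>b\<close>. Either carrying the 1s along with the rows preserves the maximal chain size,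
  or leaving all 1s in place does. If \<open>p < q\<close>, the first move only destroys chains through both
  1s, and when it destroys all maximal ones the second move works. The delicate case is \<open>q < p\<close>:
  if a chain \<open>C\<close> made by the first move and a chain \<open>D\<close> made by the second both had size \<open>k\<close>,
  larger than all chains of \<open>M\<close>, then splitting both above row \<open>b\<close> and exchanging tails would give
  two chains of \<open>M\<close> with \<open>2 k - 1\<close> cells in total, so one of size at least \<open>k\<close>.\<close>

section \<open>Chains as sets of cells\<close>

definition ne_lt :: "cell \<Rightarrow> cell \<Rightarrow> bool" where
  "ne_lt u v \<longleftrightarrow> fst u < fst v \<and> snd u < snd v"

text \<open>Chains are plain sets with a pairwise condition instead of indexed sequences, so subsets
  are chains at once and pieces of two chains can be joined. \<open>F\<close> stands for the set of
  cells filled with 1.\<close>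

definition ne_set :: "cell set \<Rightarrow> cell set \<Rightarrow> cell set \<Rightarrow> bool" where
  "ne_set P F C \<longleftrightarrow> finite C \<and> C \<subseteq> F \<and>
     (\<forall>u\<in>C. \<forall>v\<in>C. (fst u, snd v) \<in> P \<and> (u = v \<or> ne_lt u v \<or> ne_lt v u))"

text \<open>Agreement of this predicate for all \<open>k\<close> gives equal maxima, while proofs
  can concentrate on a single critical size.\<close>

definition has_ne :: "cell set \<Rightarrow> cell set \<Rightarrow> nat \<Rightarrow> bool" where
  "has_ne P F k \<longleftrightarrow> (\<exists>C. ne_set P F C \<and> card C = k)"

lemma ne_setI:
  assumes "finite C" and "C \<subseteq> F"
    and "\<And>u v. u \<in> C \<Longrightarrow> v \<in> C \<Longrightarrow> (fst u, snd v) \<in> P"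
    and "\<And>u v. u \<in> C \<Longrightarrow> v \<in> C \<Longrightarrow> u \<noteq> v \<Longrightarrow> ne_lt u v \<or> ne_lt v u"
  shows "ne_set P F C"
  using assms unfolding ne_set_def by blast

lemma ne_setD:
  assumes "ne_set P F C"
  shows "finite C" and "C \<subseteq> F"
    and "\<And>u v. u \<in> C \<Longrightarrow> v \<in> C \<Longrightarrow> (fst u, snd v) \<in> P"
    and "\<And>u v. u \<in> C \<Longrightarrow> v \<in> C \<Longrightarrow> u = v \<or> ne_lt u v \<or> ne_lt v u"
  using assms unfolding ne_set_def by blast+

lemma ne_set_subset: "ne_set P F C \<Longrightarrow> C' \<subseteq> C \<Longrightarrow> ne_set P F C'"
  unfolding ne_set_def by (meson finite_subset subset_iff)

lemma ne_set_subset_card: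
  assumes "ne_set P F C" and "k \<le> card C"
  obtains C' where "C' \<subseteq> C" and "ne_set P F C'" and "card C' = k"
  using assms by (meson ne_set_subset obtain_subset_with_card_n)

lemma has_ne_mono: "has_ne P F k \<Longrightarrow> m \<le> k \<Longrightarrow> has_ne P F m"
  unfolding has_ne_def by (meson ne_set_subset_card)

lemma ne_set_has: "ne_set P F C \<Longrightarrow> m \<le> card C \<Longrightarrow> has_ne P F m"
  unfolding has_ne_def by (meson ne_set_subset_card)

section \<open>Row interchange and half turn of the plane\<close>

definition swap_rows :: "int \<Rightarrow> int \<Rightarrow> cell \<Rightarrow> cell" where
  "swap_rows a b u = (fst u, transpose a b (snd u))"

lemma swap_rows_swap_rows [simp]: "swap_rows a b (swap_rows a b u) = u"
  by (simp add: swap_rows_def)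

lemma inj_swap_rows: "inj_on (swap_rows a b) A"
  by (metis inj_onI swap_rows_swap_rows)

lemma swap_rows_image_iff: "u \<in> swap_rows a b ` P \<longleftrightarrow> swap_rows a b u \<in> P"
  by (metis imageE image_eqI swap_rows_swap_rows)

lemma swap_rows_image_image [simp]: "swap_rows a b ` swap_rows a b ` P = P"
  by (simp add: image_image)

lemma interchange_rows_eq: "interchange_rows a b P = swap_rows a b ` P"
  unfolding interchange_rows_def swap_rows_def by (simp add: case_prod_unfold)

text \<open>Negating both coordinates reverses the order along a chain but keeps it an ne-chain,
  which a reflection in one coordinate would not do; it also turns the upper swapped row into the
  lower one.\<close>

definition half_turn :: "cell \<Rightarrow> cell" where
  "half_turn u = (- fst u, - snd u)"

lemma half_turn_half_turn [simp]: "half_turn (half_turn u) = u"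
  by (simp add: half_turn_def)

lemma half_turn_image_iff: "u \<in> half_turn ` P \<longleftrightarrow> half_turn u \<in> P"
  by (metis imageE image_eqI half_turn_half_turn)

lemma half_turn_swap_rows: "half_turn (swap_rows a b u) = swap_rows (- b) (- a) (half_turn u)"
  by (auto simp: half_turn_def swap_rows_def transpose_def)

lemma ne_set_half_turn:
  assumes "ne_set P F C"
  shows "ne_set (half_turn ` P) (half_turn ` F) (half_turn ` C)"
proof (rule ne_setI)
  show "finite (half_turn ` C)" and "half_turn ` C \<subseteq> half_turn ` F"
    using ne_setD(1,2)[OF assms] by auto
next
  fix u v assume "u \<in> half_turn ` C" "v \<in> half_turn ` C"
  then obtain u' v' where uv: "u' \<in> C" "v' \<in> C" "u = half_turn u'" "v = half_turn v'"
    by blast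
  show "(fst u, snd v) \<in> half_turn ` P"
    using ne_setD(3)[OF assms uv(1,2)] unfolding half_turn_image_iff uv by (simp add: half_turn_def)
  show "u \<noteq> v \<Longrightarrow> ne_lt u v \<or> ne_lt v u"
    using ne_setD(4)[OF assms uv(1,2)] uv(3,4) by (auto simp: half_turn_def ne_lt_def)
qed

lemma has_ne_half_turn: "has_ne (half_turn ` P) (half_turn ` F) k \<longleftrightarrow> has_ne P F k"
proof -
  have imp: "has_ne (half_turn ` P) (half_turn ` F) k" if "has_ne P F k" for P F
  proof -
    have "inj_on half_turn C" for C
      by (metis inj_onI half_turn_half_turn)
    then show ?thesis
      using that unfolding has_ne_def by (metis ne_set_half_turn card_image)
  qed
  show ?thesis
    using imp[of P F] imp[of "half_turn ` P" "half_turn ` F"] by (auto simp: image_image)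
qed

text \<open>A chain meeting only one of the two swapped rows keeps its order and its rectangle.\<close>

lemma ne_set_swap_rows:
  assumes C: "ne_set P F C" and ab: "a < b"
    and gap: "\<And>i j. (i, j) \<in> P \<Longrightarrow> \<not> (a < j \<and> j < b)"
    and one: "\<And>i i'. (i, a) \<in> C \<Longrightarrow> (i', b) \<in> C \<Longrightarrow> False"
  shows "ne_set (swap_rows a b ` P) (swap_rows a b ` F) (swap_rows a b ` C)"
proof (rule ne_setI)
  show "finite (swap_rows a b ` C)" and "swap_rows a b ` C \<subseteq> swap_rows a b ` F"
    using ne_setD(1,2)[OF C] by auto
next
  fix u v assume "u \<in> swap_rows a b ` C" "v \<in> swap_rows a b ` C"
  then obtain u' v' where uv: "u' \<in> C" "v' \<in> C" "u = swap_rows a b u'" "v = swap_rows a b v'"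
    by blast
  show "(fst u, snd v) \<in> swap_rows a b ` P"
    using ne_setD(3)[OF C uv(1,2)] unfolding swap_rows_image_iff uv by (simp add: swap_rows_def)
  assume "u \<noteq> v"
  then have "ne_lt u' v' \<or> ne_lt v' u'"
    using ne_setD(4)[OF C uv(1,2)] uv by auto
  moreover have "ne_lt (swap_rows a b x) (swap_rows a b y)"
    if "x \<in> C" "y \<in> C" "ne_lt x y" for x y
  proof -
    have "\<not> (a < snd x \<and> snd x < b)" "\<not> (a < snd y \<and> snd y < b)"
      using gap ne_setD(3)[OF C] that by blast+
    moreover have "\<not> (snd x = a \<and> snd y = b)"
      using one that by (metis prod.collapse)
    ultimately show ?thesis
      using that(3) ab unfolding ne_lt_def swap_rows_def transpose_def by auto
  qed
  ultimately show "ne_lt u v \<or> ne_lt v u" using uv by blast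
qed

section \<open>A short row directly above a long one\<close>

text \<open>\<open>F\<close> is the set of 1s, at most one per row. Nonexceptionality is phrased by
  strict inclusion of rows, which is the form in which comparability delivers it.\<close>

locale short_above_long =
  fixes M F :: "cell set" and a b :: int
  assumes ab: "a < b"
    and gap: "\<And>i j. (i, j) \<in> M \<Longrightarrow> \<not> (a < j \<and> j < b)"
    and conn: "\<And>i i' m j. (i, j) \<in> M \<Longrightarrow> (i', j) \<in> M \<Longrightarrow> i \<le> m \<Longrightarrow> m \<le> i' \<Longrightarrow> (m, j) \<in> M"
    and comp: "\<And>j j'. row_cols M j \<subseteq> row_cols M j' \<or> row_cols M j' \<subseteq> row_cols M j"
    and nonexc: "\<And>i j u d. (i, j) \<in> M \<Longrightarrow> j \<notin> {a, b} \<Longrightarrow> d < j \<Longrightarrow> j < u \<Longrightarrow>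
        row_cols M j \<subset> row_cols M d \<Longrightarrow> row_cols M j \<subset> row_cols M u \<Longrightarrow> False"
    and short: "\<And>i. (i, b) \<in> M \<Longrightarrow> (i, a) \<in> M"
    and FM: "F \<subseteq> M"
    and uniq: "\<And>i i' j. (i, j) \<in> F \<Longrightarrow> (i', j) \<in> F \<Longrightarrow> i = i'"
begin

abbreviation "N \<equiv> swap_rows a b ` M"
abbreviation "G \<equiv> swap_rows a b ` F"

lemma N_a: "(i, a) \<in> N \<longleftrightarrow> (i, b) \<in> M"
  and N_b: "(i, b) \<in> N \<longleftrightarrow> (i, a) \<in> M"
  and N_other: "j \<noteq> a \<Longrightarrow> j \<noteq> b \<Longrightarrow> (i, j) \<in> N \<longleftrightarrow> (i, j) \<in> M"
  and G_a: "(i, a) \<in> G \<longleftrightarrow> (i, b) \<in> F"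
  and G_b: "(i, b) \<in> G \<longleftrightarrow> (i, a) \<in> F"
  and G_other: "j \<noteq> a \<Longrightarrow> j \<noteq> b \<Longrightarrow> (i, j) \<in> G \<longleftrightarrow> (i, j) \<in> F"
  unfolding swap_rows_image_iff by (simp_all add: swap_rows_def)

lemma N_gap: "(i, j) \<in> N \<Longrightarrow> \<not> (a < j \<and> j < b)"
  using gap N_other by (metis less_irrefl)

lemma ne_set_to_N:
  assumes "ne_set M F C" and "\<And>i i'. (i, a) \<in> C \<Longrightarrow> (i', b) \<in> C \<Longrightarrow> False"
  shows "has_ne N G (card C)"
proof -
  have "ne_set N G (swap_rows a b ` C)"
    by (rule ne_set_swap_rows[OF assms(1) ab]) (use gap assms(2) in blast)+
  then show ?thesis
    unfolding has_ne_def using card_image[OF inj_swap_rows, of a b C] by blast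
qed

lemma ne_set_to_M:
  assumes "ne_set N G C" and "\<And>i i'. (i, a) \<in> C \<Longrightarrow> (i', b) \<in> C \<Longrightarrow> False"
  shows "ne_set M F (swap_rows a b ` C)"
proof -
  have "ne_set (swap_rows a b ` N) (swap_rows a b ` G) (swap_rows a b ` C)"
    by (rule ne_set_swap_rows[OF assms(1) ab]) (use N_gap assms(2) in blast)+
  then show ?thesis by simp
qed

text \<open>With the 1s left in place, passing from \<open>N\<close> back to \<open>M\<close> can
  shrink only row \<open>b\<close>; hence only a chain that uses row \<open>b\<close> and a column
  outside the short row can be lost.\<close>

lemma ne_set_M_of_N:
  assumes D: "ne_set N F D" and "(\<forall>i. (i, b) \<notin> D) \<or> (\<forall>u\<in>D. (fst u, b) \<in> M)"
  shows "ne_set M F D"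
proof (rule ne_setI[OF ne_setD(1,2)[OF D]])
  fix u v assume uv: "u \<in> D" "v \<in> D"
  note uvN = ne_setD(3)[OF D uv]
  show "(fst u, snd v) \<in> M"
    using assms(2) N_other[of "snd v" "fst u"] N_a[of "fst u"] short uv uvN
    by (metis prod.collapse)
  show "u \<noteq> v \<Longrightarrow> ne_lt u v \<or> ne_lt v u" using ne_setD(4)[OF D uv] by blast
qed

text \<open>Passing from \<open>M\<close> to \<open>N\<close> can shrink only row \<open>a\<close>,
  and only down to the short row.\<close>

lemma ne_set_N_of_M:
  assumes C: "ne_set M F C" and "\<And>u. u \<in> C \<Longrightarrow> (fst u, b) \<in> M"
  shows "ne_set N F C"
proof (rule ne_setI[OF ne_setD(1,2)[OF C]])
  fix u v assume uv: "u \<in> C" "v \<in> C"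
  show "(fst u, snd v) \<in> N"
    using assms(2)[OF uv(1)] N_other[of "snd v" "fst u"] N_a[of "fst u"] N_b[of "fst u"] short
      ne_setD(3)[OF C uv] by metis
  show "u \<noteq> v \<Longrightarrow> ne_lt u v \<or> ne_lt v u" using ne_setD(4)[OF C uv] by blast
qed

lemma F_subset_N:
  assumes "(p, a) \<in> F" and "(p, b) \<in> M"
  shows "F \<subseteq> N"
proof
  fix u assume u: "u \<in> F"
  have uM: "(fst u, snd u) \<in> M" using u FM by auto
  consider "snd u = a" | "snd u = b" | "snd u \<noteq> a" "snd u \<noteq> b" by blast
  then have "(fst u, snd u) \<in> N"
  proof cases
    case 1
    then have "fst u = p" using uniq assms u by (metis prod.collapse)
    then show ?thesis using N_a assms 1 by simp
  next
    case 2
    then show ?thesis using N_b short uM by simp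
  next
    case 3
    then show ?thesis using N_other uM by blast
  qed
  then show "u \<in> N" by simp
qed

section \<open>Chains lost by carrying the 1s along\<close>

lemma columns_inside:
  assumes "ne_set M F C" "(q, b) \<in> C" "u \<in> C"
  shows "(fst u, b) \<in> M"
  using ne_setD(3)[OF assms(1,3,2)] by simp

text \<open>The lost chain \<open>C0\<close> must use the 1s of both swapped rows, so its columns
  lie in the short row and it survives in \<open>N\<close> when the 1s stay. The first conclusion
  provides the hypotheses of \<open>F_subset_N\<close>.\<close>

lemma keep_of_increasing:
  assumes k: "ne_set M F C0" "card C0 = k" and bad: "\<not> has_ne N G k"
  shows "\<exists>p q. (p, a) \<in> F \<and> (q, b) \<in> F \<and> (p, b) \<in> M"
    and "has_ne M F m \<longleftrightarrow> has_ne N F m"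
proof -
  obtain p q where pq: "(p, a) \<in> C0" "(q, b) \<in> C0"
    using ne_set_to_N[OF k(1)] k(2) bad by blast
  note inF = subsetD[OF ne_setD(2)[OF k(1)]]
  have p: "(p, b) \<in> M" using columns_inside[OF k(1) pq(2,1)] by simp
  show "\<exists>p q. (p, a) \<in> F \<and> (q, b) \<in> F \<and> (p, b) \<in> M"
    using pq p inF by blast
  \<comment> \<open>A subchain of size exactly \<open>k\<close> missing one of the two rows could be
    carried along to \<open>N\<close>, against \<open>bad\<close>.\<close>
  have both: "(p, a) \<in> C \<and> (q, b) \<in> C" if C: "ne_set M F C" "k \<le> card C" for C
  proof -
    obtain C' where C': "C' \<subseteq> C" "ne_set M F C'" "card C' = k"
      using ne_set_subset_card C by blast
    then obtain i i' where "(i, a) \<in> C'" "(i', b) \<in> C'"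
      using ne_set_to_N[OF C'(2)] bad by blast
    moreover from this have "i = p" "i' = q"
      using uniq inF pq ne_setD(2)[OF C'(2)] by blast+
    ultimately show ?thesis using C' by blast
  qed
  have C0N: "ne_set N F C0" using ne_set_N_of_M[OF k(1)] columns_inside[OF k(1) pq(2)] by blast
  show "has_ne M F m \<longleftrightarrow> has_ne N F m"
  proof (cases "m \<le> k")
    case True
    then show ?thesis using k C0N ne_set_has by blast
  next
    case False
    show ?thesis
    proof
      assume "has_ne M F m"
      then obtain C where C: "ne_set M F C" "card C = m" unfolding has_ne_def by blast
      then have "(q, b) \<in> C" using both False by simp
      then show "has_ne N F m"
        using ne_set_N_of_M[OF C(1)] columns_inside[OF C(1)] C(2) unfolding has_ne_def by blast
    next
      assume "has_ne N F m"
      then obtain D where D: "ne_set N F D" "card D = m" unfolding has_ne_def by blast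
      \<comment> \<open>Without \<open>(q, b)\<close> the chain fits into \<open>M\<close>, and
        \<open>m > k\<close> leaves at least \<open>k\<close> cells; by \<open>both\<close> it would
        contain the removed cell. So no such \<open>D\<close> exists.\<close>
      have Dm: "ne_set N F (D - {(q, b)})" using ne_set_subset[OF D(1)] by blast
      have "(i, b) \<notin> D - {(q, b)}" for i
        using uniq inF[OF pq(2)] ne_setD(2)[OF D(1)] by blast
      then have "ne_set M F (D - {(q, b)})" using ne_set_M_of_N[OF Dm] by blast
      moreover have "k \<le> card (D - {(q, b)})"
        using False D(2) ne_setD(1)[OF D(1)] by (auto simp: card_Diff_singleton_if)
      ultimately have "(q, b) \<in> D - {(q, b)}" using both by blast
      then show "has_ne M F m" by blast
    qed
  qed
qed

section \<open>Recombining chains\<close>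

lemma row_superset:
  assumes "i \<in> row_cols M j" and "i \<notin> row_cols M j'" and "(x, j') \<in> M"
  shows "(x, j) \<in> M"
  using comp[of j j'] assms unfolding row_cols_def by blast

text \<open>Nonexceptionality: a row above \<open>b\<close> that misses a column of row \<open>a\<close> lies above every
  row having that column.\<close>

lemma rows_above_ordered:
  assumes "(i, a) \<in> M" and "(i, j) \<notin> M" and "(x, j) \<in> M" and "b < j" and "(i, j') \<in> M"
  shows "j' < j"
proof (rule ccontr)
  assume "\<not> j' < j"
  then have "j < j'" using assms by (cases "j = j'") auto
  \<comment> \<open>Row \<open>j\<close> would be strictly contained both in row \<open>a\<close>
    below it and in row \<open>j'\<close> above it, hence exceptional.\<close>
  moreover have "row_cols M j \<subset> row_cols M l" if "(i, l) \<in> M" for l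
    using comp[of j l] that assms(2) unfolding row_cols_def by blast
  ultimately show False
    using nonexc[OF assms(3), of a j'] assms ab by auto
qed

section \<open>Chains gained by carrying the 1s along\<close>

context
  fixes p q :: int and C :: "cell set" and k :: nat
  assumes C: "ne_set N G C" and cardC: "card C = k"
    and none: "\<not> has_ne M F k"
    and pC: "(p, b) \<in> C" and qC: "(q, a) \<in> C"
begin

text \<open>The cell \<open>(q, a)\<close> forces all columns of \<open>C\<close> into row
  \<open>a\<close> of \<open>N\<close>, which is the short row.\<close>

lemma C_inside: "u \<in> C \<Longrightarrow> (fst u, b) \<in> M"
  using ne_setD(3)[OF C _ qC] N_a by simp

lemma p_F: "(p, a) \<in> F" and q_F: "(q, b) \<in> F"
  using ne_setD(2)[OF C] pC qC G_a G_b by blast+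

lemma p_inside: "(p, b) \<in> M"
  using C_inside[OF pC] by simp

lemma q_less_p: "q < p"
  using ne_setD(4)[OF C pC qC] ab by (auto simp: ne_lt_def)

context
  fixes D :: "cell set"
  assumes D: "ne_set N F D" and cardD: "card D = k"
begin

text \<open>\<open>(q, b)\<close> is the only 1 in row \<open>b\<close>; avoiding it,
  \<open>D\<close> would be a chain of \<open>M\<close> of the forbidden size
  \<open>k\<close>.\<close>

lemma q_D: "(q, b) \<in> D"
proof (rule ccontr)
  assume "(q, b) \<notin> D"
  then have "(i, b) \<notin> D" for i using uniq[OF q_F] ne_setD(2)[OF D] by blast
  then show False using ne_set_M_of_N[OF D] cardD none unfolding has_ne_def by blast
qed

lemma D_long: "u \<in> D \<Longrightarrow> (fst u, a) \<in> M"
  using ne_setD(3)[OF D _ q_D] N_b by simp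

lemma D_outside: obtains d where "d \<in> D" and "(fst d, b) \<notin> M"
  using ne_set_M_of_N[OF D] cardD none unfolding has_ne_def by blast

text \<open>As \<open>q < p\<close>, the 1s \<open>(p, a)\<close> and \<open>(q, b)\<close> are not
  in ne-order. Hence \<open>D\<close> has one cell in the swapped rows while \<open>C\<close> has
  two, which decides the final count.\<close>

lemma a_notin_D: "(i, a) \<notin> D"
proof
  assume "(i, a) \<in> D"
  moreover from this have "i = p" using uniq[OF p_F] ne_setD(2)[OF D] by blast
  ultimately show False
    using ne_setD(4)[OF D q_D, of "(p, a)"] q_less_p ab by (auto simp: ne_lt_def)
qed

lemma C_row:
  assumes "u \<in> C" and "snd u < a \<or> b < snd u" and "c \<in> C" and "c' \<in> C"
    and "fst c \<le> i" and "i \<le> fst c'"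
  shows "(i, snd u) \<in> M"
proof -
  have "(fst c, snd u) \<in> M" "(fst c', snd u) \<in> M"
    using ne_setD(3)[OF C assms(3,1)] ne_setD(3)[OF C assms(4,1)] assms(2) N_other[of "snd u"] ab
    by fastforce+
  then show ?thesis using conn assms by blast
qed

text \<open>The columns of \<open>D\<close> do not all fit into row \<open>b\<close>, so its rows contain row \<open>b\<close>; the rows
  of \<open>C\<close> need not contain all columns of \<open>D\<close>.\<close>

lemma wide_row:
  assumes "\<And>d. d \<in> D \<Longrightarrow> (fst d, j) \<in> M" and "(i, b) \<in> M \<or> i \<in> fst ` D"
  shows "(i, j) \<in> M"
proof -
  obtain d where "d \<in> D" "(fst d, b) \<notin> M" using D_outside .
  then show ?thesis
    using row_superset[of "fst d" j b i] assms unfolding row_cols_def by blast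
qed

lemma D_row:
  assumes "u \<in> D" and "snd u < a \<or> b < snd u" and "(i, b) \<in> M \<or> i \<in> fst ` D"
  shows "(i, snd u) \<in> M"
  using wide_row[OF _ assms(3), of "snd u"] ne_setD(3)[OF D _ assms(1)] assms(2)
    N_other[of "snd u"] ab by (metis less_irrefl less_trans)

text \<open>The cells of \<open>C\<close> and \<open>D\<close> above row \<open>b\<close> are cut so that their tails can be exchanged: \<open>C\<close> after
  \<open>x\<close>, and \<open>D\<close> before column \<open>T\<close>. The cell \<open>x\<close> is the last one, among those whose rows contain all
  columns of \<open>D\<close>, such that no cell of \<open>D\<close> to its right is weakly below it.\<close>

lemma above_split:
  obtains x T where "fst x < T" and "x = (p, b) \<or> x \<in> C \<and> b < snd x"
    and "\<And>d y. d \<in> D \<Longrightarrow> y \<in> C \<Longrightarrow> b < snd y \<Longrightarrow> fst y \<le> fst x \<Longrightarrow> (fst d, snd y) \<in> M"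
    and "\<And>z. z \<in> D \<Longrightarrow> b < snd z \<Longrightarrow> T \<le> fst z \<Longrightarrow> snd x < snd z"
    and "\<And>w. w \<in> C \<Longrightarrow> fst x < fst w \<Longrightarrow> T \<le> fst w"
    and "\<And>z. z \<in> D \<Longrightarrow> b < snd z \<Longrightarrow> fst z < T \<Longrightarrow> \<exists>c\<in>C. fst z \<le> fst c"
    and "\<And>z w. z \<in> D \<Longrightarrow> b < snd z \<Longrightarrow> fst z < T \<Longrightarrow> w \<in> C \<Longrightarrow> fst x < fst w \<Longrightarrow> snd z < snd w"
proof -
  define B1 where "B1 = {y \<in> C. b < snd y \<and> (\<forall>d\<in>D. (fst d, snd y) \<in> M)}"
  define Q where "Q x \<longleftrightarrow> (\<forall>z\<in>D. b < snd z \<and> fst x < fst z \<longrightarrow> snd x < snd z)" for x :: cell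
  \<comment> \<open>\<open>(p, b)\<close> makes \<open>X\<close> nonempty: \<open>Q\<close> holds
    for it because \<open>Q\<close> only looks at cells of \<open>D\<close> above row
    \<open>b\<close>. Its own row does not contain all columns of \<open>D\<close>.\<close>
  define X where "X = {x \<in> insert (p, b) B1. Q x}"
  have lt: "ne_lt u v" if "u \<in> C" "v \<in> C" "fst u < fst v" for u v
    using ne_setD(4)[OF C that(1,2)] that(3) by (auto simp: ne_lt_def)
  have ltD: "ne_lt u v" if "u \<in> D" "v \<in> D" "fst u < fst v" for u v
    using ne_setD(4)[OF D that(1,2)] that(3) by (auto simp: ne_lt_def)
  have "finite X" using ne_setD(1)[OF C] unfolding X_def B1_def by auto
  moreover have "(p, b) \<in> X" unfolding X_def Q_def by auto
  ultimately have "Max (fst ` X) \<in> fst ` X" and le: "\<forall>y\<in>X. fst y \<le> Max (fst ` X)"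
    by (metis Max_in empty_iff finite_imageI image_is_empty) (simp add: \<open>finite X\<close>)
  then obtain x where x: "x \<in> X" and max: "\<And>y. y \<in> X \<Longrightarrow> fst y \<le> fst x"
    by (metis imageE)
  have xC: "x \<in> C" and bx: "b \<le> snd x" using x pC unfolding X_def B1_def by auto
  have above: "b < snd w" if "w \<in> C" "fst x < fst w" for w
    using lt[OF xC that] bx by (auto simp: ne_lt_def)
  \<comment> \<open>The row of \<open>w\<close> misses a column of \<open>D\<close> that the row of
    \<open>z\<close> has, so \<open>rows_above_ordered\<close> puts \<open>z\<close> lower.\<close>
  have B2: "snd z < snd w" if zw: "z \<in> D" "b < snd z" "w \<in> C" "b < snd w" "w \<notin> B1" for z w
  proof -
    obtain d where d: "d \<in> D" "(fst d, snd w) \<notin> M" using zw unfolding B1_def by blast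
    show ?thesis
      using rows_above_ordered[OF D_long[OF d(1)] d(2), of p "snd z"] zw(4)
        C_row[OF zw(3) _ pC pC, of p] D_row[OF zw(1), of "fst d"] zw(2) d(1) by auto
  qed
  \<comment> \<open>If the row of \<open>y\<close> missed a column of \<open>D\<close>, the row of
    \<open>x\<close>, having that column, would lie below \<open>y\<close>, although
    \<open>y\<close> precedes \<open>x\<close> in \<open>C\<close>.\<close>
  have B1I: "y \<in> B1" if y: "y \<in> C" "b < snd y" "fst y \<le> fst x" for y
  proof (cases "y = x")
    case True
    then show ?thesis using x y unfolding X_def by auto
  next
    case False
    then have yx: "ne_lt y x" using ne_setD(4)[OF C y(1) xC] y(3) by (auto simp: ne_lt_def)
    show ?thesis
    proof (rule ccontr)
      assume "y \<notin> B1"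
      then obtain d where d: "d \<in> D" "(fst d, snd y) \<notin> M" using y unfolding B1_def by blast
      have "x \<in> B1" using x yx y(2) unfolding X_def by (auto simp: ne_lt_def)
      then have "(fst d, snd x) \<in> M" using d unfolding B1_def by blast
      then have "snd x < snd y"
        using rows_above_ordered[OF D_long[OF d(1)] d(2), of p "snd x"] y(2)
          C_row[OF y(1) _ pC pC, of p] by auto
      then show False using yx by (auto simp: ne_lt_def)
    qed
  qed
  define W where "W = {w \<in> C. fst x < fst w}"
  have finW: "finite W" using ne_setD(1)[OF C] unfolding W_def by auto
  \<comment> \<open>\<open>T\<close> is the column of the first cell of \<open>C\<close> to the
    right of \<open>x\<close>. If there is none, the default \<open>fst x + 1\<close> makes "before
    \<open>T\<close>" mean "not to the right of \<open>x\<close>", so that \<open>x\<close> itself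
    bounds those cells of \<open>D\<close>.\<close>
  obtain T where T: "fst x < T" "\<And>w. w \<in> W \<Longrightarrow> T \<le> fst w"
    "W = {} \<and> T = fst x + 1 \<or> (\<exists>w0\<in>W. fst w0 = T)"
  proof (cases "W = {}")
    case True
    then show ?thesis using that[of "fst x + 1"] by auto
  next
    case False
    have "Min (fst ` W) \<in> fst ` W" using finW False by simp
    then obtain w0 where w0: "w0 \<in> W" "fst w0 = Min (fst ` W)" by (metis imageE)
    have "fst x < fst w0" using w0(1) unfolding W_def by blast
    moreover have "fst w0 \<le> fst w" if "w \<in> W" for w
      using finW that unfolding w0(2) by simp
    ultimately show ?thesis using that[of "fst w0"] w0(1) by blast
  qed
  have Qx: "snd x < snd z" if "z \<in> D" "b < snd z" "fst x < fst z" for z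
    using x that unfolding X_def Q_def by blast
  show ?thesis
  proof (rule that[of x T])
    show "fst x < T" by fact
    show "x = (p, b) \<or> x \<in> C \<and> b < snd x" using x unfolding X_def B1_def by auto
    show "(fst d, snd y) \<in> M" if "d \<in> D" "y \<in> C" "b < snd y" "fst y \<le> fst x" for d y
      using B1I that unfolding B1_def by blast
    show "snd x < snd z" if "z \<in> D" "b < snd z" "T \<le> fst z" for z
      using Qx that T(1) by simp
    show "T \<le> fst w" if "w \<in> C" "fst x < fst w" for w
      using T(2) that unfolding W_def by blast
    show "\<exists>c\<in>C. fst z \<le> fst c" if "fst z < T" for z :: cell
    proof (cases "W = {}")
      case True
      then show ?thesis using T(3) xC that by force
    next
      case False
      then obtain w0 where "w0 \<in> C" "fst w0 = T" using T(3) unfolding W_def by blast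
      then show ?thesis using \<open>fst z < T\<close> by (intro bexI[of _ w0]) simp_all
    qed
    fix z w assume z: "z \<in> D" "b < snd z" "fst z < T" and w: "w \<in> C" "fst x < fst w"
    obtain w0 where w0: "w0 \<in> C" "fst x < fst w0" "fst w0 = T"
      using T(3) w unfolding W_def by blast
    have "snd z < snd w0"
    proof (cases "w0 \<in> B1")
      case False
      then show ?thesis using B2 z w0 above by blast
    next
      case True
      \<comment> \<open>By maximality of \<open>x\<close>, some cell \<open>z'\<close> of
        \<open>D\<close> to the right of \<open>w0\<close> is weakly below it, and \<open>z\<close>
        precedes \<open>z'\<close> in \<open>D\<close>.\<close>
      then have "\<not> Q w0" using max[of w0] w0(2) unfolding X_def by auto
      then obtain z' where "z' \<in> D" "fst w0 < fst z'" "snd z' \<le> snd w0"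
        unfolding Q_def by (metis linorder_not_le)
      then show ?thesis using ltD[OF z(1), of z'] z(3) w0(3) by (auto simp: ne_lt_def)
    qed
    moreover have "snd w0 \<le> snd w"
    proof (cases "w = w0")
      case False
      then show ?thesis
        using ne_setD(4)[OF C w(1) w0(1)] w0(3) T(2)[of w] w unfolding W_def
        by (auto simp: ne_lt_def)
    qed simp
    ultimately show "snd z < snd w" by simp
  qed
qed

lemma no_long_chain: False
proof (rule above_split)
  fix x :: cell and T :: int
  assume xT: "fst x < T" and x: "x = (p, b) \<or> x \<in> C \<and> b < snd x"
    and wide: "\<And>d y. d \<in> D \<Longrightarrow> y \<in> C \<Longrightarrow> b < snd y \<Longrightarrow> fst y \<le> fst x \<Longrightarrow> (fst d, snd y) \<in> M"
    and Z2x: "\<And>z. z \<in> D \<Longrightarrow> b < snd z \<Longrightarrow> T \<le> fst z \<Longrightarrow> snd x < snd z"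
    and X2T: "\<And>w. w \<in> C \<Longrightarrow> fst x < fst w \<Longrightarrow> T \<le> fst w"
    and Z1C: "\<And>z. z \<in> D \<Longrightarrow> b < snd z \<Longrightarrow> fst z < T \<Longrightarrow> \<exists>c\<in>C. fst z \<le> fst c"
    and Z1X2: "\<And>z w. z \<in> D \<Longrightarrow> b < snd z \<Longrightarrow> fst z < T \<Longrightarrow> w \<in> C \<Longrightarrow> fst x < fst w \<Longrightarrow> snd z < snd w"
  define A X1 X2 where "A = {u \<in> C. snd u < a}"
    and "X1 = {u \<in> C. b < snd u \<and> fst u \<le> fst x}" and "X2 = {u \<in> C. b < snd u \<and> fst x < fst u}"
  define A' Z1 Z2 where "A' = {u \<in> D. snd u < a}"
    and "Z1 = {u \<in> D. b < snd u \<and> fst u < T}" and "Z2 = {u \<in> D. b < snd u \<and> T \<le> fst u}"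
  note defs = A_def X1_def X2_def A'_def Z1_def Z2_def
  \<comment> \<open>\<open>E1\<close> follows \<open>C\<close> below row \<open>a\<close>, then
    \<open>D\<close> from \<open>(q, b)\<close> up to column \<open>T\<close>, then the tail of
    \<open>C\<close>. \<open>E2\<close> takes the complementary pieces, with the 1 of
    \<open>C\<close> at \<open>(p, b)\<close> put back to its place \<open>(p, a)\<close> in
    \<open>M\<close>.\<close>
  define E1 where "E1 = insert (q, b) (A \<union> Z1 \<union> X2)"
  define E2 where "E2 = insert (p, a) (A' \<union> X1 \<union> Z2)"
  have finCD: "finite C" "finite D" using ne_setD(1) C D by blast+
  have fin: "finite A" "finite X1" "finite X2" "finite A'" "finite Z1" "finite Z2"
    unfolding defs using finCD by auto
  have xC: "x \<in> C" and bx: "b \<le> snd x" using x pC by auto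
  have totC: "u = v \<or> ne_lt u v \<or> ne_lt v u" if "u \<in> C" "v \<in> C" for u v
    using ne_setD(4)[OF C that] .
  have totD: "u = v \<or> ne_lt u v \<or> ne_lt v u" if "u \<in> D" "v \<in> D" for u v
    using ne_setD(4)[OF D that] .
  have colA: "fst u < q" if "u \<in> A" for u
    using totC[OF _ qC, of u] that unfolding A_def ne_lt_def by auto
  have colA': "fst u < q" if "u \<in> A'" for u
    using totD[OF _ q_D, of u] that ab unfolding A'_def ne_lt_def by auto
  have colC: "p < fst u" if "u \<in> C" "b < snd u" for u
    using totC[OF that(1) pC] that unfolding ne_lt_def by auto
  have colD: "q < fst u" if "u \<in> D" "b < snd u" for u
    using totD[OF that(1) q_D] that unfolding ne_lt_def by auto
  have px: "p \<le> fst x" using x colC by fastforce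
  have A: "u \<in> C" "snd u < a" "fst u < q" if "u \<in> A" for u
    using that colA[OF that] unfolding A_def by auto
  have A': "u \<in> D" "snd u < a" "fst u < q" if "u \<in> A'" for u
    using that colA'[OF that] unfolding A'_def by auto
  have X1: "u \<in> C" "b < snd u" "p < fst u" "fst u \<le> fst x" "snd u \<le> snd x" if "u \<in> X1" for u
    using that colC[of u] totC[OF _ xC, of u] unfolding X1_def ne_lt_def by auto
  have X2: "u \<in> C" "b < snd u" "p < fst u" "fst x < fst u" "T \<le> fst u" if "u \<in> X2" for u
    using that colC[of u] X2T[of u] unfolding X2_def by auto
  have Z1: "u \<in> D" "b < snd u" "q < fst u" "fst u < T" if "u \<in> Z1" for u
    using that colD[of u] unfolding Z1_def by auto
  have Z2: "u \<in> D" "b < snd u" "T \<le> fst u" "snd x < snd u" if "u \<in> Z2" for u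
    using that Z2x[of u] unfolding Z2_def by auto
  have ltE1: "\<And>u z. u \<in> A \<Longrightarrow> z \<in> Z1 \<Longrightarrow> ne_lt u z" "\<And>u w. u \<in> A \<Longrightarrow> w \<in> X2 \<Longrightarrow> ne_lt u w"
    "\<And>z w. z \<in> Z1 \<Longrightarrow> w \<in> X2 \<Longrightarrow> ne_lt z w" "\<And>u. u \<in> A \<Longrightarrow> ne_lt u (q, b)"
    "\<And>z. z \<in> Z1 \<Longrightarrow> ne_lt (q, b) z" "\<And>w. w \<in> X2 \<Longrightarrow> ne_lt (q, b) w"
  proof -
    show "ne_lt u z" if "u \<in> A" "z \<in> Z1" for u z
      using A[OF that(1)] Z1[OF that(2)] ab unfolding ne_lt_def by linarith
    show "ne_lt u w" if "u \<in> A" "w \<in> X2" for u w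
      using A[OF that(1)] X2[OF that(2)] q_less_p ab unfolding ne_lt_def by linarith
    show "ne_lt z w" if "z \<in> Z1" "w \<in> X2" for z w
      using Z1[OF that(1)] X2[OF that(2)] Z1X2[of z w] unfolding ne_lt_def by linarith
    show "ne_lt u (q, b)" if "u \<in> A" for u
      using A[OF that] ab unfolding ne_lt_def by simp
    show "ne_lt (q, b) z" if "z \<in> Z1" for z
      using Z1[OF that] unfolding ne_lt_def by simp
    show "ne_lt (q, b) w" if "w \<in> X2" for w
      using X2[OF that] q_less_p unfolding ne_lt_def by simp
  qed
  have ltE2: "\<And>u y. u \<in> A' \<Longrightarrow> y \<in> X1 \<Longrightarrow> ne_lt u y" "\<And>u z. u \<in> A' \<Longrightarrow> z \<in> Z2 \<Longrightarrow> ne_lt u z"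
    "\<And>y z. y \<in> X1 \<Longrightarrow> z \<in> Z2 \<Longrightarrow> ne_lt y z" "\<And>u. u \<in> A' \<Longrightarrow> ne_lt u (p, a)"
    "\<And>y. y \<in> X1 \<Longrightarrow> ne_lt (p, a) y" "\<And>z. z \<in> Z2 \<Longrightarrow> ne_lt (p, a) z"
  proof -
    show "ne_lt u y" if "u \<in> A'" "y \<in> X1" for u y
      using A'[OF that(1)] X1[OF that(2)] q_less_p ab unfolding ne_lt_def by linarith
    show "ne_lt u z" if "u \<in> A'" "z \<in> Z2" for u z
      using A'[OF that(1)] Z2[OF that(2)] xT px q_less_p ab unfolding ne_lt_def by linarith
    show "ne_lt y z" if "y \<in> X1" "z \<in> Z2" for y z
      using X1[OF that(1)] Z2[OF that(2)] xT unfolding ne_lt_def by linarith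
    show "ne_lt u (p, a)" if "u \<in> A'" for u
      using A'[OF that] q_less_p unfolding ne_lt_def by simp
    show "ne_lt (p, a) y" if "y \<in> X1" for y
      using X1[OF that] ab unfolding ne_lt_def by simp
    show "ne_lt (p, a) z" if "z \<in> Z2" for z
      using Z2[OF that] xT px ab unfolding ne_lt_def by simp
  qed
  have GF: "u \<in> F" if "u \<in> C" "snd u < a \<or> b < snd u" for u
    using G_other[of "snd u" "fst u"] ne_setD(2)[OF C] that ab by auto
  have E1: "ne_set M F E1"
  proof (rule ne_setI)
    show "finite E1" unfolding E1_def using fin by simp
    show "E1 \<subseteq> F"
      using GF A(1,2) X2(1,2) Z1(1) q_F ne_setD(2)[OF D] unfolding E1_def by blast
    fix u v assume uv: "u \<in> E1" "v \<in> E1"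
    show "u \<noteq> v \<Longrightarrow> ne_lt u v \<or> ne_lt v u"
      using uv ltE1 totC[of u v] totD[of u v] A(1) Z1(1) X2(1) unfolding E1_def by blast
    obtain c c' where c: "c \<in> C" "c' \<in> C" "fst c \<le> fst u" "fst u \<le> fst c'"
    proof -
      consider "u \<in> C" | "u \<in> Z1" | "u = (q, b)"
        using uv(1) A(1) X2(1) unfolding E1_def by blast
      then show ?thesis
      proof cases
        case 1
        then show ?thesis using that[of u u] by simp
      next
        case 2
        then obtain c' where "c' \<in> C" "fst u \<le> fst c'" using Z1C[OF Z1(1,2,4)] by blast
        then show ?thesis using that[OF qC] Z1(3)[OF 2] by simp
      next
        case 3
        then show ?thesis using that[OF qC qC] by simp
      qed
    qed
    \<comment> \<open>Every column of \<open>E1\<close> lies between two columns of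
      \<open>C\<close>, hence in the short row, and the rows coming from \<open>D\<close> contain
      the short row.\<close>
    have inside: "(fst u, b) \<in> M" using conn[OF C_inside[OF c(1)] C_inside[OF c(2)] c(3,4)] .
    consider "v \<in> C" "snd v < a \<or> b < snd v" | "v \<in> D" "b < snd v" | "v = (q, b)"
      using uv(2) A(1,2) X2(1,2) Z1(1,2) unfolding E1_def by blast
    then show "(fst u, snd v) \<in> M"
      using C_row[OF _ _ c] D_row[of v "fst u"] inside by cases auto
  qed
  have E2: "ne_set M F E2"
  proof (rule ne_setI)
    show "finite E2" unfolding E2_def using fin by simp
    show "E2 \<subseteq> F"
      using GF X1(1,2) A'(1) Z2(1) p_F ne_setD(2)[OF D] unfolding E2_def by blast
    fix u v assume uv: "u \<in> E2" "v \<in> E2"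
    show "u \<noteq> v \<Longrightarrow> ne_lt u v \<or> ne_lt v u"
      using uv ltE2 totC[of u v] totD[of u v] A'(1) Z2(1) X1(1) unfolding E2_def by blast
    \<comment> \<open>Columns of \<open>E2\<close> may leave the short row, but every row of
      \<open>E2\<close> contains both the short row and all columns of \<open>D\<close>.\<close>
    have col: "(fst u, b) \<in> M \<or> fst u \<in> fst ` D"
      using uv(1) p_inside C_inside[of u] A'(1)[of u] X1(1)[of u] Z2(1)[of u] unfolding E2_def by auto
    consider "v \<in> D" "snd v < a \<or> b < snd v" | "v \<in> X1" | "v = (p, a)"
      using uv(2) A'(1,2) Z2(1,2) unfolding E2_def by blast
    then show "(fst u, snd v) \<in> M"
    proof cases
      case 1
      then show ?thesis using D_row col by blast
    next
      case 2
      then show ?thesis using wide_row[OF _ col] wide unfolding X1_def by blast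
    next
      case 3
      then show ?thesis using col D_long short by auto
    qed
  qed
  have irrefl: "\<not> ne_lt u u" for u unfolding ne_lt_def by simp
  have less: "card E1 < k" "card E2 < k"
    using none ne_set_has[OF E1] ne_set_has[OF E2] by (meson linorder_not_le)+
  have "card E1 = Suc (card A + card Z1 + card X2)"
  proof -
    have "A \<inter> Z1 = {}" "(A \<union> Z1) \<inter> X2 = {}" "(q, b) \<notin> A \<union> Z1 \<union> X2"
      using ltE1 irrefl by blast+
    then show ?thesis unfolding E1_def using fin by (simp add: card_Un_disjoint)
  qed
  moreover have "card E2 = Suc (card A' + card X1 + card Z2)"
  proof -
    have "A' \<inter> X1 = {}" "(A' \<union> X1) \<inter> Z2 = {}" "(p, a) \<notin> A' \<union> X1 \<union> Z2"
      using ltE2 irrefl by blast+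
    then show ?thesis unfolding E2_def using fin by (simp add: card_Un_disjoint)
  qed
  moreover have "card C \<le> card A + card X1 + card X2 + 2"
  proof -
    have "u \<in> {(q, a), (p, b)} \<union> (A \<union> X1 \<union> X2)" if u: "u \<in> C" for u
    proof -
      consider "snd u < a" | "snd u = a" | "snd u = b" | "b < snd u"
        using N_gap[OF ne_setD(3)[OF C u u]] by linarith
      moreover have "snd u = a \<Longrightarrow> u = (q, a)" "snd u = b \<Longrightarrow> u = (p, b)"
        using totC[OF u qC] totC[OF u pC] by (auto simp: ne_lt_def prod_eq_iff)
      ultimately show ?thesis using u unfolding defs by cases auto
    qed
    then have "card C \<le> card ({(q, a), (p, b)} \<union> (A \<union> X1 \<union> X2))"
      using fin by (intro card_mono) auto
    also have "\<dots> \<le> card {(q, a), (p, b)} + card (A \<union> X1 \<union> X2)" by (rule card_Un_le)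
    also have "\<dots> \<le> 2 + (card A + card X1 + card X2)"
      using card_Un_le[of "A \<union> X1" X2] card_Un_le[of A X1] ab by simp
    finally show ?thesis by simp
  qed
  moreover have "card D \<le> card A' + card Z1 + card Z2 + 1"
  proof -
    have "u \<in> {(q, b)} \<union> (A' \<union> Z1 \<union> Z2)" if u: "u \<in> D" for u
    proof -
      consider "snd u < a" | "snd u = a" | "snd u = b" | "b < snd u"
        using N_gap[OF ne_setD(3)[OF D u u]] by linarith
      moreover have "snd u \<noteq> a" "snd u = b \<Longrightarrow> u = (q, b)"
        using a_notin_D[of "fst u"] totD[OF u q_D] u by (auto simp: ne_lt_def prod_eq_iff)
      ultimately show ?thesis using u unfolding defs by cases auto
    qed
    then have "card D \<le> card ({(q, b)} \<union> (A' \<union> Z1 \<union> Z2))"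
      using fin by (intro card_mono) auto
    also have "\<dots> \<le> card {(q, b)} + card (A' \<union> Z1 \<union> Z2)" by (rule card_Un_le)
    also have "\<dots> \<le> 1 + (card A' + card Z1 + card Z2)"
      using card_Un_le[of "A' \<union> Z1" Z2] card_Un_le[of A' Z1] by simp
    finally show ?thesis by simp
  qed
  \<comment> \<open>\<open>C\<close> gives up two cells, \<open>D\<close> one, and each new chain
    gains one: the total is at least \<open>2 k - 1\<close>, but \<open>less\<close> allows only
    \<open>2 k - 2\<close>.\<close>
  ultimately show False using less cardC cardD by linarith
qed

end

text \<open>Below \<open>k\<close> both sides hold, thanks to a common chain of size
  \<open>k - 1\<close>; from \<open>k\<close> on both fail.\<close>

lemma keep_of_decreasing: "has_ne M F m \<longleftrightarrow> has_ne N F m"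
proof (cases "m < k")
  case True
  \<comment> \<open>Dropping \<open>(p, b)\<close> leaves only one swapped row in use, so the chain
    can be moved back to \<open>M\<close>; its columns stay in the short row, so it is also a chain
    of \<open>N\<close> with the 1s in place.\<close>
  define C' where "C' = C - {(p, b)}"
  have C': "ne_set N G C'" using ne_set_subset[OF C] unfolding C'_def by blast
  have "(i, b) \<notin> C'" for i
    using ne_setD(4)[OF C pC, of "(i, b)"] unfolding C'_def ne_lt_def by auto
  then have M': "ne_set M F (swap_rows a b ` C')" using ne_set_to_M[OF C'] by blast
  have "(fst u, b) \<in> M" if "u \<in> swap_rows a b ` C'" for u
    using that C_inside unfolding C'_def swap_rows_def by auto
  then have N': "ne_set N F (swap_rows a b ` C')" using ne_set_N_of_M[OF M'] by blast
  have "card (swap_rows a b ` C') = k - 1"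
    using cardC pC ne_setD(1)[OF C] unfolding C'_def by (simp add: card_image[OF inj_swap_rows])
  then show ?thesis using ne_set_has[OF M', of m] ne_set_has[OF N', of m] True by simp
next
  case False
  then have "\<not> has_ne M F m" using none has_ne_mono by (meson linorder_not_less)
  moreover have "\<not> has_ne N F m"
  proof
    assume "has_ne N F m"
    then obtain D where "ne_set N F D" "card D = k"
      using has_ne_mono False unfolding has_ne_def[of N F k, symmetric]
      by (metis has_ne_def linorder_not_less)
    then show False by (rule no_long_chain)
  qed
  ultimately show ?thesis by blast
qed

end

text \<open>A size on which the first alternative fails gives either a lost or a gained chain. The
  second alternative records that both swapped rows carry a 1, which is needed for the row
  sums.\<close>

lemma swap_or_keep:
  "(\<forall>k. has_ne N G k \<longleftrightarrow> has_ne M F k) \<or>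
   (\<exists>p q. (p, a) \<in> F \<and> (q, b) \<in> F) \<and> F \<subseteq> N \<and> (\<forall>k. has_ne N F k \<longleftrightarrow> has_ne M F k)"
proof (cases "\<forall>k. has_ne N G k \<longleftrightarrow> has_ne M F k")
  case False
  then obtain k where k: "has_ne N G k \<noteq> has_ne M F k" by blast
  show ?thesis
  proof (cases "has_ne M F k")
    case True
    then obtain C where C: "ne_set M F C" "card C = k" and bad: "\<not> has_ne N G k"
      using k unfolding has_ne_def by blast
    obtain p q where "(p, a) \<in> F" "(q, b) \<in> F" "(p, b) \<in> M"
      using keep_of_increasing(1)[OF C bad] by blast
    then show ?thesis using keep_of_increasing(2)[OF C bad] F_subset_N by blast
  next
    case none: False
    then obtain C where C: "ne_set N G C" "card C = k"
      using k unfolding has_ne_def by blast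
    have "\<exists>p q. (q, a) \<in> C \<and> (p, b) \<in> C"
    proof (rule ccontr)
      assume "\<not> ?thesis"
      then have "ne_set M F (swap_rows a b ` C)" using ne_set_to_M[OF C(1)] by blast
      then show False
        using none C(2) card_image[OF inj_swap_rows, of a b C] unfolding has_ne_def by blast
    qed
    then obtain p q where pq: "(p, b) \<in> C" "(q, a) \<in> C" by blast
    note C' = C none pq
    show ?thesis
      using p_F[OF C'] q_F[OF C'] F_subset_N[OF p_F[OF C'] p_inside[OF C']] keep_of_decreasing[OF C']
      by blast
  qed
qed simp

end

section \<open>Almost-moon polyominoes and fillings\<close>

lemma row_cols_half_turn: "row_cols (half_turn ` P) j = uminus ` row_cols P (- j)"
  unfolding row_cols_def half_turn_image_iff by (force simp: half_turn_def image_iff)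

lemma row_cols_half_turn_subset:
  "row_cols (half_turn ` P) j \<subseteq> row_cols (half_turn ` P) j' \<longleftrightarrow> row_cols P (- j) \<subseteq> row_cols P (- j')"
  unfolding row_cols_half_turn by (rule inj_image_subset_iff) (simp add: inj_on_def)

lemma almost_moon_swap_or_keep:
  assumes moon: "almost_moon M" and adj: "adjacent_rows M a b"
    and exc: "\<And>j. exceptional_row M j \<Longrightarrow> j \<in> {a, b}"
    and FM: "F \<subseteq> M" and uniq: "\<And>i i' j. (i, j) \<in> F \<Longrightarrow> (i', j) \<in> F \<Longrightarrow> i = i'"
    and N: "N = swap_rows a b ` M"
  shows "(\<forall>k. has_ne N (swap_rows a b ` F) k \<longleftrightarrow> has_ne M F k) \<or>
    (\<exists>p q. (p, a) \<in> F \<and> (q, b) \<in> F) \<and> F \<subseteq> N \<and> (\<forall>k. has_ne N F k \<longleftrightarrow> has_ne M F k)"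
proof -
  have in_rows: "(i, j) \<in> M \<Longrightarrow> j \<in> rows M" for i j unfolding rows_def by force
  have empty: "row_cols M j = {}" if "j \<notin> rows M" for j
    using that in_rows unfolding row_cols_def by blast
  have ab: "a < b" and gap: "\<And>i j. (i, j) \<in> M \<Longrightarrow> \<not> (a < j \<and> j < b)"
    using adj in_rows unfolding adjacent_rows_def by fastforce+
  have conn: "(m, j) \<in> M" if "(i, j) \<in> M" "(i', j) \<in> M" "i \<le> m" "m \<le> i'" for i i' m j
  proof -
    have "row_connected M j" using moon in_rows that unfolding almost_moon_def by blast
    then have "{i..i'} \<subseteq> row_cols M j" using that unfolding row_connected_def row_cols_def by blast
    then show ?thesis using that unfolding row_cols_def by auto
  qed
  have comp: "row_cols M j \<subseteq> row_cols M j' \<or> row_cols M j' \<subseteq> row_cols M j" for j j'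
    using moon empty[of j] empty[of j'] unfolding almost_moon_def rows_comparable_def by blast
  have fin: "finite (row_cols M j)" for j
  proof (rule finite_subset)
    show "row_cols M j \<subseteq> fst ` M" unfolding row_cols_def by force
    show "finite (fst ` M)" using moon unfolding almost_moon_def by simp
  qed
  have nonexc: False if "(i, j) \<in> M" "j \<notin> {a, b}" "d < j" "j < u"
    "row_cols M j \<subset> row_cols M d" "row_cols M j \<subset> row_cols M u" for i j u d
  proof -
    have "d \<in> rows M" "u \<in> rows M" using that empty[of d] empty[of u] by auto
    moreover have "row_length M j < row_length M d" "row_length M j < row_length M u"
      using that fin psubset_card_mono unfolding row_length_def by blast+
    ultimately have "exceptional_row M j"
      using in_rows that unfolding exceptional_row_def by blast
    then show False using exc that by blast
  qed
  show ?thesis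
  proof (cases "row_cols M b \<subseteq> row_cols M a")
    case True
    then have short: "(i, b) \<in> M \<Longrightarrow> (i, a) \<in> M" for i unfolding row_cols_def by blast
    interpret short_above_long M F a b
      by unfold_locales (fact ab gap conn comp nonexc short FM uniq)+
    show ?thesis using swap_or_keep unfolding N .
  next
    case False
    then have short: "(i, a) \<in> M \<Longrightarrow> (i, b) \<in> M" for i
      using comp[of a b] unfolding row_cols_def by blast
    \<comment> \<open>When the long row is on top, the half turn gives rows \<open>- b < - a\<close>
      with the short one on top; the longer rows above and below exchange roles.\<close>
    interpret H: short_above_long "half_turn ` M" "half_turn ` F" "- b" "- a"
    proof
      show "- b < - a" using ab by simp
      show "\<not> (- b < j \<and> j < - a)" if "(i, j) \<in> half_turn ` M" for i j
        using gap that unfolding half_turn_image_iff by (force simp: half_turn_def)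
      show "(m, j) \<in> half_turn ` M"
        if "(i, j) \<in> half_turn ` M" "(i', j) \<in> half_turn ` M" "i \<le> m" "m \<le> i'" for i i' m j
        using conn[of "- i'" "- j" "- i" "- m"] that unfolding half_turn_image_iff
        by (simp add: half_turn_def)
      show "row_cols (half_turn ` M) j \<subseteq> row_cols (half_turn ` M) j' \<or>
        row_cols (half_turn ` M) j' \<subseteq> row_cols (half_turn ` M) j" for j j'
        unfolding row_cols_half_turn_subset by (rule comp)
      show False if "(i, j) \<in> half_turn ` M" "j \<notin> {- b, - a}" "d < j" "j < u"
        "row_cols (half_turn ` M) j \<subset> row_cols (half_turn ` M) d"
        "row_cols (half_turn ` M) j \<subset> row_cols (half_turn ` M) u" for i j u d
        using nonexc[of "- i" "- j" "- u" "- d"] that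
        unfolding half_turn_image_iff less_le_not_le row_cols_half_turn_subset
        by (auto simp: half_turn_def)
      show "(i, - b) \<in> half_turn ` M" if "(i, - a) \<in> half_turn ` M" for i
        using short that unfolding half_turn_image_iff by (simp add: half_turn_def)
      show "half_turn ` F \<subseteq> half_turn ` M" using FM by blast
      show "i = i'" if "(i, j) \<in> half_turn ` F" "(i', j) \<in> half_turn ` F" for i i' j
        using uniq[of "- i" "- j" "- i'"] that unfolding half_turn_image_iff
        by (simp add: half_turn_def)
    qed
    have turn: "swap_rows (- b) (- a) ` half_turn ` P = half_turn ` swap_rows a b ` P" for P
      by (simp add: image_image half_turn_swap_rows)
    have sub: "half_turn ` F \<subseteq> half_turn ` P \<longleftrightarrow> F \<subseteq> P" for P
      by (rule inj_image_subset_iff) (metis injI half_turn_half_turn)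
    have cells: "(\<exists>p q. (p, - b) \<in> half_turn ` F \<and> (q, - a) \<in> half_turn ` F) \<Longrightarrow>
        \<exists>p q. (p, a) \<in> F \<and> (q, b) \<in> F"
      unfolding half_turn_image_iff by (auto simp: half_turn_def)
    show ?thesis using H.swap_or_keep cells unfolding turn sub has_ne_half_turn N by blast
  qed
qed

text \<open>Distinct cells of a chain have distinct columns, so sorting the columns recovers the
  indexing.\<close>

lemma ne_chain_iff_ne_set:
  "ne_chain P f k C \<longleftrightarrow> ne_set P {u \<in> P. f u = 1} C \<and> card C = k"
proof
  assume "ne_chain P f k C"
  then obtain x y where C: "C = (\<lambda>s. (x s, y s)) ` {1..k}"
    and x: "strict_mono_on {1..k} x" and y: "strict_mono_on {1..k} y"
    and f: "\<forall>s\<in>{1..k}. f (x s, y s) = 1" and P: "\<forall>s\<in>{1..k}. \<forall>t\<in>{1..k}. (x s, y t) \<in> P"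
    unfolding ne_chain_def by blast
  have "inj_on (\<lambda>s. (x s, y s)) {1..k}"
    using strict_mono_on_imp_inj_on[OF x] unfolding inj_on_def by blast
  then have "card C = k" unfolding C by (simp add: card_image)
  moreover have "ne_set P {u \<in> P. f u = 1} C"
  proof (rule ne_setI)
    show "finite C" unfolding C by simp
    show "C \<subseteq> {u \<in> P. f u = 1}" unfolding C using f P by blast
    fix u v assume "u \<in> C" "v \<in> C"
    then obtain s t where st: "s \<in> {1..k}" "t \<in> {1..k}" "u = (x s, y s)" "v = (x t, y t)"
      unfolding C by blast
    show "(fst u, snd v) \<in> P" using P st(1,2) unfolding st(3,4) fst_conv snd_conv by blast
    assume "u \<noteq> v"
    then consider "s < t" | "t < s" using st(3,4) linorder_cases by metis
    then show "ne_lt u v \<or> ne_lt v u"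
      using strict_mono_onD[OF x st(1,2)] strict_mono_onD[OF x st(2,1)]
        strict_mono_onD[OF y st(1,2)] strict_mono_onD[OF y st(2,1)]
      unfolding st(3,4) ne_lt_def fst_conv snd_conv by cases simp_all
  qed
  ultimately show "ne_set P {u \<in> P. f u = 1} C \<and> card C = k" by blast
next
  assume "ne_set P {u \<in> P. f u = 1} C \<and> card C = k"
  then have C: "ne_set P {u \<in> P. f u = 1} C" and k: "card C = k" by auto
  note D = ne_setD[OF C]
  have inj: "inj_on fst C"
  proof (rule inj_onI)
    show "u = v" if "u \<in> C" "v \<in> C" "fst u = fst v" for u v
      using D(4)[OF that(1,2)] that(3) by (auto simp: ne_lt_def)
  qed
  define l where "l = sorted_list_of_set (fst ` C)"
  have l: "set l = fst ` C" "length l = k" "sorted_wrt (<) l"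
    unfolding l_def using D(1) k card_image[OF inj] by simp_all
  define g where "g = the_inv_into C fst"
  have g: "g (fst u) = u" if "u \<in> C" for u
    unfolding g_def using the_inv_into_f_f[OF inj that] .
  have gl: "g (l ! (s - 1)) \<in> C \<and> fst (g (l ! (s - 1))) = l ! (s - 1)" if s: "s \<in> {1..k}" for s
  proof -
    have "s - 1 < length l" using l(2) s by auto
    then have "l ! (s - 1) \<in> fst ` C" using l(1) nth_mem by blast
    then obtain u where "u \<in> C" "l ! (s - 1) = fst u" by blast
    then show ?thesis using g[of u] by simp
  qed
  \<comment> \<open>The shift by one matches the index range \<open>{1..k}\<close> with list
    positions starting at 0.\<close>
  define x y where "x s = fst (g (l ! (s - 1)))" and "y s = snd (g (l ! (s - 1)))" for s
  have xy: "(x s, y s) = g (l ! (s - 1))" for s unfolding x_def y_def by simp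
  have lt: "ne_lt (x s, y s) (x t, y t)" if "s \<in> {1..k}" "t \<in> {1..k}" "s < t" for s t
  proof -
    have "l ! (s - 1) < l ! (t - 1)" 
      using sorted_wrt_nth_less[OF l(3), of "s - 1" "t - 1"] l(2) that by auto
    then show ?thesis
      using D(4)[of "g (l ! (s - 1))" "g (l ! (t - 1))"] gl[OF that(1)] gl[OF that(2)]
      unfolding xy ne_lt_def by auto
  qed
  have "C = (\<lambda>s. (x s, y s)) ` {1..k}"
  proof
    show "C \<subseteq> (\<lambda>s. (x s, y s)) ` {1..k}"
    proof
      fix u assume u: "u \<in> C"
      then have "fst u \<in> set l" using l(1) by blast
      then obtain i where i: "i < k" "l ! i = fst u" using l(2) unfolding in_set_conv_nth by blast
      then have "u = (x (Suc i), y (Suc i))" using g[OF u] unfolding xy by simp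
      then show "u \<in> (\<lambda>s. (x s, y s)) ` {1..k}" using i by auto
    qed
    show "(\<lambda>s. (x s, y s)) ` {1..k} \<subseteq> C" using gl unfolding xy by blast
  qed
  moreover have "strict_mono_on {1..k} x" "strict_mono_on {1..k} y"
    using lt unfolding ne_lt_def by (auto intro!: strict_mono_onI)
  moreover have "\<forall>s\<in>{1..k}. f (x s, y s) = 1"
    using gl D(2) unfolding xy by blast
  moreover have "\<forall>s\<in>{1..k}. \<forall>t\<in>{1..k}. (x s, y t) \<in> P"
    using gl D(3) unfolding x_def y_def by blast
  ultimately show "ne_chain P f k C" unfolding ne_chain_def by blast
qed

lemma ne_eq: "ne P f = Max {k. has_ne P {u \<in> P. f u = 1} k}"
  unfolding ne_def has_ne_def ne_chain_iff_ne_set ..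

section \<open>Row and column sums as cardinalities\<close>

lemma sum_01_eq_card:
  fixes f :: "'a \<Rightarrow> nat"
  assumes "finite S" and "\<And>x. x \<in> S \<Longrightarrow> f x \<in> {0, 1}"
  shows "sum f S = card {x \<in> S. f x = 1}"
proof -
  have "sum f S = (\<Sum>x\<in>S. if f x = 1 then 1 else 0)"
    using assms by (intro sum.cong) auto
  then show ?thesis using assms(1) by (simp add: sum.inter_filter[symmetric])
qed

lemma finite_lines:
  assumes "finite P"
  shows "finite (row_cols P j)" and "finite (col_rows P i)"
proof -
  have "row_cols P j \<subseteq> fst ` P" "col_rows P i \<subseteq> snd ` P"
    unfolding row_cols_def col_rows_def by force+
  then show "finite (row_cols P j)" and "finite (col_rows P i)"
    using assms finite_subset by blast+
qed

lemma fillings_iff: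
  assumes "finite P" and f: "f \<in> P \<rightarrow>\<^sub>E {0, 1}"
  shows "f \<in> fillings P r c \<longleftrightarrow>
    (\<forall>j\<in>rows P. card (row_cols {u \<in> P. f u = 1} j) = r j) \<and>
    (\<forall>i\<in>columns P. card (col_rows {u \<in> P. f u = 1} i) = c i)"
proof -
  have "(\<Sum>i\<in>row_cols P j. f (i, j)) = card (row_cols {u \<in> P. f u = 1} j)" for j
  proof -
    have "(\<Sum>i\<in>row_cols P j. f (i, j)) = card {i \<in> row_cols P j. f (i, j) = 1}"
      using f by (intro sum_01_eq_card finite_lines[OF assms(1)]) (auto simp: row_cols_def)
    then show ?thesis unfolding row_cols_def by simp
  qed
  moreover have "(\<Sum>j\<in>col_rows P i. f (i, j)) = card (col_rows {u \<in> P. f u = 1} i)" for i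
  proof -
    have "(\<Sum>j\<in>col_rows P i. f (i, j)) = card {j \<in> col_rows P i. f (i, j) = 1}"
      using f by (intro sum_01_eq_card finite_lines[OF assms(1)]) (auto simp: col_rows_def)
    then show ?thesis unfolding col_rows_def by simp
  qed
  ultimately show ?thesis using f unfolding fillings_def by simp
qed

theorem theorem3:
  fixes M N :: "cell set" and a b :: int and r c :: "int \<Rightarrow> nat"
  assumes "almost_moon M" and "almost_moon N"
    and "adjacent_rows M a b" and "N = interchange_rows a b M"
    and "\<And>j. exceptional_row M j \<Longrightarrow> j \<in> {a, b}"
    and "\<And>j. exceptional_row N j \<Longrightarrow> j \<in> {a, b}"
    and "\<And>j. j \<in> rows M \<Longrightarrow> r j \<in> {0, 1}"
  shows "\<exists>\<psi> \<in> fillings M r c \<rightarrow> fillings N (r(a := r b, b := r a)) c.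
           \<forall>f \<in> fillings M r c. ne N (\<psi> f) = ne M f"
proof -
  have N: "N = swap_rows a b ` M" using assms(4) interchange_rows_eq by simp
  have finM: "finite M" and finN: "finite N"
    using assms(1,2) unfolding almost_moon_def by blast+
  have abM: "a \<in> rows M" "b \<in> rows M" using assms(3) unfolding adjacent_rows_def by blast+
  have "rows N = transpose a b ` rows M"
    unfolding N rows_def by (simp add: image_image swap_rows_def)
  then have rowsN: "rows N = rows M" using abM by (simp add: transpose_image_eq)
  have columnsN: "columns N = columns M"
    unfolding N columns_def by (simp add: image_image swap_rows_def)
  have "\<exists>g\<in>fillings N (r(a := r b, b := r a)) c. ne N g = ne M f" if f: "f \<in> fillings M r c" for f
  proof -
    define F where "F = {u \<in> M. f u = 1}"
    have f01: "f \<in> M \<rightarrow>\<^sub>E {0, 1}" using f unfolding fillings_def by blast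
    have FM: "F \<subseteq> M" unfolding F_def by blast
    have rowF: "\<And>j. j \<in> rows M \<Longrightarrow> card (row_cols F j) = r j"
      and colF: "\<And>i. i \<in> columns M \<Longrightarrow> card (col_rows F i) = c i"
      using f fillings_iff[OF finM f01] unfolding F_def by blast+
    have finF: "finite F" using FM finM finite_subset by blast
    have uniq: "i = i'" if "(i, j) \<in> F" "(i', j) \<in> F" for i i' j
    proof -
      have "j \<in> rows M" using that FM unfolding rows_def by force
      then have "card (row_cols F j) \<le> Suc 0" using rowF assms(7) by fastforce
      then show ?thesis
        using that card_le_Suc0_iff_eq[OF finite_lines(1)[OF finF]] unfolding row_cols_def by blast
    qed
    have keep: "(\<forall>k. has_ne N (swap_rows a b ` F) k \<longleftrightarrow> has_ne M F k) \<or>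
      (\<exists>p q. (p, a) \<in> F \<and> (q, b) \<in> F) \<and> F \<subseteq> N \<and> (\<forall>k. has_ne N F k \<longleftrightarrow> has_ne M F k)"
      by (rule almost_moon_swap_or_keep[OF assms(1,3) _ FM _ N]) (fact assms(5) uniq)+
    \<comment> \<open>\<open>G\<close> is the set of 1s of the image filling: either the swapped
      \<open>F\<close> or \<open>F\<close> itself.\<close>
    obtain G where GN: "G \<subseteq> N" and ne: "\<And>k. has_ne N G k \<longleftrightarrow> has_ne M F k"
      and rowG: "\<And>j. j \<in> rows M \<Longrightarrow> card (row_cols G j) = (r(a := r b, b := r a)) j"
      and colG: "\<And>i. card (col_rows G i) = card (col_rows F i)"
    proof (cases "\<forall>k. has_ne N (swap_rows a b ` F) k \<longleftrightarrow> has_ne M F k")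
      case True
      have "card (row_cols (swap_rows a b ` F) j) = (r(a := r b, b := r a)) j"
        if j: "j \<in> rows M" for j
      proof -
        have "row_cols (swap_rows a b ` F) j = row_cols F (transpose a b j)"
          unfolding row_cols_def swap_rows_image_iff by (simp add: swap_rows_def)
        then show ?thesis using rowF abM j by (auto simp: transpose_def)
      qed
      moreover have "card (col_rows (swap_rows a b ` F) i) = card (col_rows F i)" for i
      proof -
        have "col_rows (swap_rows a b ` F) i = transpose a b -` col_rows F i"
          unfolding col_rows_def swap_rows_image_iff by (simp add: swap_rows_def vimage_def)
        then show ?thesis by (simp add: card_vimage_inj)
      qed
      moreover have "swap_rows a b ` F \<subseteq> N" using FM unfolding N by blast
      ultimately show ?thesis using that True by blast
    next
      case False
      then obtain p q where pq: "(p, a) \<in> F" "(q, b) \<in> F" and FN: "F \<subseteq> N"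
        and ne: "\<And>k. has_ne N F k \<longleftrightarrow> has_ne M F k"
        using keep by blast
      have "row_cols F a = {p}" "row_cols F b = {q}"
        using pq uniq unfolding row_cols_def by blast+
      \<comment> \<open>Both entries are 1, so exchanging them leaves \<open>r\<close> unchanged and
        the 1s may stay.\<close>
      then have "r a = 1" "r b = 1" using rowF[OF abM(1)] rowF[OF abM(2)] by simp_all
      then show ?thesis using that[OF FN ne] rowF by simp
    qed
    define g where "g = (\<lambda>u\<in>N. if u \<in> G then 1 else 0 :: nat)"
    have g01: "g \<in> N \<rightarrow>\<^sub>E {0, 1}" unfolding g_def by auto
    have gG: "{u \<in> N. g u = 1} = G" using GN unfolding g_def by auto
    have "g \<in> fillings N (r(a := r b, b := r a)) c"
      unfolding fillings_iff[OF finN g01] gG rowsN columnsN using rowG colG colF by simp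
    moreover have "ne N g = ne M f"
      unfolding ne_eq gG F_def[symmetric] ne ..
    ultimately show ?thesis by blast
  qed
  \<comment> \<open>An image is chosen for each filling separately.\<close>
  then obtain \<psi> where "\<And>f. f \<in> fillings M r c \<Longrightarrow>
      \<psi> f \<in> fillings N (r(a := r b, b := r a)) c \<and> ne N (\<psi> f) = ne M f"
    by metis
  then show ?thesis by blast
qed

end
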